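(* For $L>0$, let $F_{\mathrm{W}}=\{f:[0,1]\to\mathbb{R};\ \|f\|_{\mathrm{W}}\le L\}$ and $F_{\mathrm{S}}=\{f:[0,1]\to\mathbb{R};\ \|f\|_{\mathrm{S}}\le L\}$, where $\|f\|_{\mathrm{W}}$ and $\|f\|_{\mathrm{S}}$ are the weak and strong average smoothness of $f$. Then: (1) $\mathrm{fat}_\gamma(F_{\mathrm{W}})=\infty$ for every $\gamma>0$ with $\gamma\le \frac{L}{6}$; (2) $\mathrm{fat}_\gamma(F_{\mathrm{S}})=1+\left\lfloor\frac{L}{2\gamma}\right\rfloor$ for every $\gamma>0$.
   Context: For $f:[0,1]\to\mathbb{R}$ and $x\in[0,1]$, the local slope of $f$ at $x$ is $$\Lambda_f(x)=\sup_{x'\in[0,1]\setminus\{x\}}\frac{|f(x)-f(x')|}{|x-x'|}\in[0,\infty].$$ Let $U$ be the uniform distribution (Lebesgue measure) on $[0,1]$ and let $X$ be a random variable distributed according to $U$. The strong average smoothness of $f$ is $\|f\|_{\mathrm{S}}=\mathbb{E}[\Lambda_f(X)]\in[0,\infty]$. The weak average smoothness of $f$ is $\|f\|_{\mathrm{W}}=\sup_{t>0}\,t\,U(\{x\in[0,1]:\Lambda_f(x)\ge t\})\in[0,\infty]$. Fat-shattering dimension: let $F$ be a collection of functions from $[0,1]$ to $\mathbb{R}$ and let $\gamma>0$. A finite set $S=\{x_1,\dots,x_m\}\subset[0,1]$ of $m$ distinct points is $\gamma$-shattered by $F$ if $$\sup_{r\in\mathbb{R}^m}\ \min_{y\in\{-1,1\}^m}\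 \sup_{f\in F}\ \min_{1\le i\le m}\ y_i\,(f(x_i)-r_i)\ \ge\ \gamma.$$ The $\gamma$-fat-shattering dimension $\mathrm{fat}_\gamma(F)$ is the size of the largest $\gamma$-shattered set; it equals $\infty$ if there are $\gamma$-shattered sets of arbitrarily large size. *)

theory Defs
  imports "HOL-Probability.Probability"
begin

(* Since x' = x is excluded, no division by zero occurs in the supremum. *)
definition local_slope :: "(real \<Rightarrow> real) \<Rightarrow> real \<Rightarrow> ennreal" where
  "local_slope f x = (SUP x' \<in> {0..1} - {x}. ennreal (\<bar>f x - f x'\<bar> / \<bar>x - x'\<bar>))"

definition unif01 :: "real measure" where
  "unif01 = uniform_measure lborel {0..1}"

(* No measurability assumption on f is needed below: the local slope is infinite at every
   discontinuity of f, and its superlevel sets are relatively open in the (Borel) set of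
   continuity points, so the local slope of an arbitrary f is Borel on [0,1]. *)
definition strong_smoothness :: "(real \<Rightarrow> real) \<Rightarrow> ennreal" where
  "strong_smoothness f = (\<integral>\<^sup>+ x. local_slope f x \<partial>unif01)"

definition weak_smoothness :: "(real \<Rightarrow> real) \<Rightarrow> ennreal" where
  "weak_smoothness f =
     (SUP t \<in> {0<..}. ennreal t * emeasure unif01 {x \<in> {0..1}. local_slope f x \<ge> ennreal t})"

(* Functions from [0,1] to the reals are represented as extensional functions on {0..1}. *)
definition F_W :: "real \<Rightarrow> (real \<Rightarrow> real) set" where
  "F_W L = {f \<in> {0..1} \<rightarrow>\<^sub>E UNIV. weak_smoothness f \<le> ennreal L}"

definition F_S :: "real \<Rightarrow> (real \<Rightarrow> real) set" where
  "F_S L = {f \<in> {0..1} \<rightarrow>\<^sub>E UNIV. strong_smoothness f \<le> ennreal L}"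

(* The vectors r and y are indexed by the points of S themselves. Suprema and minima are taken
   in the extended reals, since the supremum over F may be infinite; both minima range over
   finite sets. *)
definition fat_shattered :: "real \<Rightarrow> (real \<Rightarrow> real) set \<Rightarrow> real set \<Rightarrow> bool" where
  "fat_shattered \<gamma> F S \<longleftrightarrow> finite S \<and> S \<subseteq> {0..1} \<and>
     (SUP r \<in> S \<rightarrow>\<^sub>E (UNIV :: real set). INF y \<in> S \<rightarrow>\<^sub>E {-1, 1 :: real}.
        SUP f \<in> F. INF x \<in> S. ereal (y x * (f x - r x))) \<ge> ereal \<gamma>"

definition fat_dim :: "real \<Rightarrow> (real \<Rightarrow> real) set \<Rightarrow> enat" where
  "fat_dim \<gamma> F = (SUP S \<in> {S. fat_shattered \<gamma> F S}. enat (card S))"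

end

theory Submission
  imports Defs
begin

text \<open>
  Both parts rest on two estimates.

  Lower bounds. Let \<open>d\<close> be a pseudometric on \<open>[0,1]\<close> for which every function that is
  \<open>1\<close>-Lipschitz with respect to \<open>d\<close> belongs to the class. Then every finite set whose points have
  pairwise \<open>d\<close>-distance at least \<open>2 \<gamma>\<close> is \<open>\<gamma>\<close>-shattered with \<open>r = 0\<close>, because the values \<open>\<plusminus>\<gamma>\<close>
  on the set are \<open>1\<close>-Lipschitz and extend by McShane's formula (\<open>separated_imp_fat_shattered\<close>).
  For the strong class the metric is \<open>L \<bar>x - y\<bar>\<close>, and \<open>n + 1\<close> equally spaced points are separated
  as soon as \<open>2 \<gamma> n \<le> L\<close>. For the weak class the metric is \<open>L \<bar>x - y\<bar> / max x y\<close>: Lipschitz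
  functions for it may have local slope as large as \<open>L / x\<close>, which is the profile extremal
  for the weak norm, and all the points \<open>1, 1/2, 1/4, \<dots>\<close> have pairwise distance at least \<open>L / 2\<close>.
  So if \<open>4 \<gamma> \<le> L\<close>, arbitrarily many points are separated and the dimension is infinite.

  Upper bound for the strong class. The mean of the local slope dominates the total variation
  (\<open>variation_le_strong_smoothness\<close>). If \<open>n + 1\<close> points are shattered, take the alternating sign
  pattern and its opposite: whatever the offsets \<open>r\<close> are, on each gap between neighbouring points
  the two functions realising these patterns with a margin \<open>\<delta> < \<gamma>\<close> have increments adding up to at
  least \<open>4 \<delta>\<close>, as the offsets cancel. Both variations are at most \<open>L\<close>, so \<open>4 \<delta> n \<le> 2 L\<close>
  (\<open>F_S_shattered_margin\<close>), and \<open>\<delta>\<close> tends to \<open>\<gamma>\<close>.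
\<close>

section \<open>Shattering separated sets\<close>

text \<open>McShane's formula: the smallest of the Lipschitz cones \<open>v s + d x s\<close>. It is stated for a
  pseudometric on a set because both metrics below are considered on \<open>[0,1]\<close> only.\<close>

lemma mcshane_extension:
  fixes d :: "'a \<Rightarrow> 'a \<Rightarrow> real" and v :: "'a \<Rightarrow> real"
  assumes refl: "\<And>x. x \<in> X \<Longrightarrow> d x x = 0"
    and sym: "\<And>x y. x \<in> X \<Longrightarrow> y \<in> X \<Longrightarrow> d x y = d y x"
    and tri: "\<And>x y z. x \<in> X \<Longrightarrow> y \<in> X \<Longrightarrow> z \<in> X \<Longrightarrow> d x z \<le> d x y + d y z"
    and S: "finite S" "S \<noteq> {}" "S \<subseteq> X"
    and lip: "\<And>s t. s \<in> S \<Longrightarrow> t \<in> S \<Longrightarrow> \<bar>v s - v t\<bar> \<le> d s t"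
  obtains f where "f \<in> X \<rightarrow>\<^sub>E UNIV" "\<And>s. s \<in> S \<Longrightarrow> f s = v s"
    "\<And>x y. x \<in> X \<Longrightarrow> y \<in> X \<Longrightarrow> \<bar>f x - f y\<bar> \<le> d x y"
proof
  define g where "g x = Min ((\<lambda>s. v s + d x s) ` S)" for x
  have g_le: "g x \<le> v s + d x s" if "s \<in> S" for x s
    unfolding g_def using S that by (intro Min_le) auto
  have g_att: "\<exists>s\<in>S. g x = v s + d x s" for x
  proof -
    have "g x \<in> (\<lambda>s. v s + d x s) ` S" unfolding g_def using S by (intro Min_in) auto
    then show ?thesis by blast
  qed
  have one_sided: "g x - g y \<le> d x y" if xy: "x \<in> X" "y \<in> X" for x y
  proof -
    obtain s where s: "s \<in> S" "g y = v s + d y s" using g_att by blast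
    have "g x \<le> v s + d x s" by (rule g_le[OF s(1)])
    also have "d x s \<le> d x y + d y s" using tri xy s S by blast
    finally show ?thesis using s by linarith
  qed
  show "restrict g X \<in> X \<rightarrow>\<^sub>E UNIV" by simp
  show "\<bar>restrict g X x - restrict g X y\<bar> \<le> d x y" if "x \<in> X" "y \<in> X" for x y
    using one_sided[OF that] one_sided[OF that(2,1)] sym[OF that] that by auto
  show "restrict g X s = v s" if s: "s \<in> S" for s
  proof -
    obtain t where t: "t \<in> S" "g s = v t + d s t" using g_att by blast
    have "g s \<ge> v s" using lip[OF s t(1)] t by linarith
    moreover have "g s \<le> v s" using g_le[OF s, of s] refl s S by auto
    ultimately show ?thesis using s S by auto
  qed
qed

lemma separated_imp_fat_shattered:
  fixes d :: "real \<Rightarrow> real \<Rightarrow> real"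
  assumes "\<gamma> > 0"
    and refl: "\<And>x. x \<in> {0..1} \<Longrightarrow> d x x = 0"
    and sym: "\<And>x y. x \<in> {0..1} \<Longrightarrow> y \<in> {0..1} \<Longrightarrow> d x y = d y x"
    and tri: "\<And>x y z. x \<in> {0..1} \<Longrightarrow> y \<in> {0..1} \<Longrightarrow> z \<in> {0..1} \<Longrightarrow> d x z \<le> d x y + d y z"
    and F: "\<And>f. f \<in> {0..1} \<rightarrow>\<^sub>E UNIV \<Longrightarrow>
      (\<And>x y. x \<in> {0..1} \<Longrightarrow> y \<in> {0..1} \<Longrightarrow> \<bar>f x - f y\<bar> \<le> d x y) \<Longrightarrow> f \<in> F"
    and S: "finite S" "S \<noteq> {}" "S \<subseteq> {0..1}"
    and sep: "\<And>s t. s \<in> S \<Longrightarrow> t \<in> S \<Longrightarrow> s \<noteq> t \<Longrightarrow> 2 * \<gamma> \<le> d s t"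
  shows "fat_shattered \<gamma> F S"
proof -
  have "ereal \<gamma> \<le> (SUP f\<in>F. INF x\<in>S. ereal (y x * (f x - restrict (\<lambda>_. 0) S x)))"
    if y: "y \<in> S \<rightarrow>\<^sub>E {-1, 1}" for y
  proof -
    have y1: "y s = 1 \<or> y s = -1" if "s \<in> S" for s using y that by (auto dest: PiE_mem)
    have lip: "\<bar>\<gamma> * y s - \<gamma> * y t\<bar> \<le> d s t" if "s \<in> S" "t \<in> S" for s t
    proof (cases "s = t")
      case True
      then show ?thesis using refl S that by auto
    next
      case False
      then show ?thesis using sep[OF that] y1[OF that(1)] y1[OF that(2)] assms(1) by auto
    qed
    obtain f where f: "f \<in> {0..1} \<rightarrow>\<^sub>E UNIV" "\<And>s. s \<in> S \<Longrightarrow> f s = \<gamma> * y s"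
      "\<And>x y. x \<in> {0..1} \<Longrightarrow> y \<in> {0..1} \<Longrightarrow> \<bar>f x - f y\<bar> \<le> d x y"
      using mcshane_extension[of "{0..1}" d S "\<lambda>s. \<gamma> * y s", OF refl sym tri S lip] by blast
    have "f \<in> F" by (rule F[OF f(1) f(3)])
    moreover have "ereal \<gamma> \<le> ereal (y x * (f x - restrict (\<lambda>_. 0) S x))" if "x \<in> S" for x
      using f(2)[OF that] y1[OF that] that by auto
    ultimately show ?thesis by (intro SUP_upper2[of f] INF_greatest)
  qed
  then have "ereal \<gamma> \<le> (SUP r \<in> S \<rightarrow>\<^sub>E (UNIV :: real set). INF y \<in> S \<rightarrow>\<^sub>E {-1, 1 :: real}.
        SUP f \<in> F. INF x \<in> S. ereal (y x * (f x - r x)))"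
    by (intro SUP_upper2[of "restrict (\<lambda>_. 0) S"]) (simp, rule INF_greatest)
  then show ?thesis using S unfolding fat_shattered_def by blast
qed

section \<open>Lower bounds on the two dimensions\<close>

lemma prob_space_unif01: "prob_space unif01"
  unfolding unif01_def by (rule prob_space_uniform_measure) auto

lemma emeasure_unif01: "A \<in> sets borel \<Longrightarrow> emeasure unif01 A = emeasure lborel ({0..1} \<inter> A)"
  unfolding unif01_def by (simp add: emeasure_uniform_measure divide_ennreal_def)

lemma Lipschitz_in_F_S:
  assumes "L > 0" "f \<in> {0..1} \<rightarrow>\<^sub>E UNIV"
    and lip: "\<And>x y. x \<in> {0..1} \<Longrightarrow> y \<in> {0..1} \<Longrightarrow> \<bar>f x - f y\<bar> \<le> L * \<bar>x - y\<bar>"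
  shows "f \<in> F_S L"
proof -
  interpret prob_space unif01 by (rule prob_space_unif01)
  have "local_slope f x \<le> ennreal L" if "x \<in> {0..1}" for x
    unfolding local_slope_def
    using lip[OF that] by (intro SUP_least ennreal_leI) (auto simp: field_simps)
  moreover have "AE x in unif01. x \<in> {0..1}"
    unfolding unif01_def by (intro AE_uniform_measureI) auto
  ultimately have "strong_smoothness f \<le> (\<integral>\<^sup>+ x. ennreal L \<partial>unif01)"
    unfolding strong_smoothness_def by (intro nn_integral_mono_AE) auto
  then show ?thesis using assms(2) emeasure_space_1 by (simp add: F_S_def)
qed

text \<open>Local slope at most \<open>L / x\<close> confines the level set \<open>{local_slope f \<ge> t}\<close> to \<open>[0, L / t]\<close>.\<close>

lemma harmonic_Lipschitz_in_F_W:
  assumes "L > 0" "f \<in> {0..1} \<rightarrow>\<^sub>E UNIV"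
    and lip: "\<And>x y. x \<in> {0..1} \<Longrightarrow> y \<in> {0..1} \<Longrightarrow> \<bar>f x - f y\<bar> \<le> L * (\<bar>x - y\<bar> / max x y)"
  shows "f \<in> F_W L"
proof -
  have slope: "local_slope f x \<le> ennreal (L / x)" if x: "x \<in> {0..1}" "x > 0" for x
    unfolding local_slope_def
  proof (intro SUP_least ennreal_leI)
    fix y assume y: "y \<in> {0..1} - {x}"
    have "\<bar>f x - f y\<bar> \<le> L * (\<bar>x - y\<bar> / max x y)" using lip x y by blast
    also have "\<dots> \<le> L * (\<bar>x - y\<bar> / x)"
      using assms(1) x by (intro mult_left_mono divide_left_mono) auto
    finally show "\<bar>f x - f y\<bar> / \<bar>x - y\<bar> \<le> L / x" using x y by (auto simp: field_simps)
  qed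
  have "ennreal t * emeasure unif01 {x \<in> {0..1}. ennreal t \<le> local_slope f x} \<le> ennreal L"
    if t: "t > 0" for t
  proof -
    have sub: "{x \<in> {0..1}. ennreal t \<le> local_slope f x} \<subseteq> {0..L / t}"
    proof safe
      fix x :: real assume x: "x \<in> {0..1}" "ennreal t \<le> local_slope f x"
      show "x \<in> {0..L / t}"
      proof (cases "x = 0")
        case True
        then show ?thesis using t assms(1) by simp
      next
        case False
        with x have "ennreal t \<le> ennreal (L / x)" using slope[of x] by (auto intro: order_trans)
        then have "t \<le> L / x" using x False assms(1) by (subst (asm) ennreal_le_iff) auto
        then show ?thesis using x False t by (auto simp: field_simps)
      qed
    qed
    have "emeasure unif01 {x \<in> {0..1}. ennreal t \<le> local_slope f x} \<le> emeasure unif01 {0..L / t}"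
      using sub by (rule emeasure_mono) (simp add: unif01_def)
    also have "\<dots> \<le> emeasure lborel {0..L / t}"
      by (subst emeasure_unif01) (auto intro!: emeasure_mono)
    also have "\<dots> = ennreal (L / t)" using t assms(1) by simp
    finally have "ennreal t * emeasure unif01 {x \<in> {0..1}. ennreal t \<le> local_slope f x}
        \<le> ennreal t * ennreal (L / t)" by (rule mult_left_mono) simp
    then show ?thesis using t assms(1) by (simp flip: ennreal_mult)
  qed
  then have "weak_smoothness f \<le> ennreal L"
    unfolding weak_smoothness_def by (intro SUP_least) auto
  then show ?thesis using assms(2) by (simp add: F_W_def)
qed

text \<open>The quotient is at most \<open>1\<close>, and \<open>0 / 0 = 0\<close> makes it vanish at the origin. If \<open>y\<close> lies outside
  the interval spanned by \<open>x\<close> and \<open>z\<close>, a single term on the right already suffices; if it lies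
  inside, split \<open>z - x\<close> at \<open>y\<close> and shrink one denominator.\<close>

lemma harmonic_triangle:
  fixes x y z :: real
  assumes "x \<ge> 0" "y \<ge> 0" "z \<ge> 0"
  shows "\<bar>x - z\<bar> / max x z \<le> \<bar>x - y\<bar> / max x y + \<bar>y - z\<bar> / max y z"
proof -
  have ordered: "\<bar>a - c\<bar> / max a c \<le> \<bar>a - b\<bar> / max a b + \<bar>b - c\<bar> / max b c"
    if abc: "0 \<le> a" "0 \<le> b" "a \<le> c" for a b c :: real
  proof (cases "c = 0")
    case True
    with abc have "a = 0" by simp
    with True show ?thesis using abc by simp
  next
    case False
    with abc have c: "c > 0" by simp
    consider "b < a" | "a \<le> b" "b \<le> c" | "c < b" by linarith
    then show ?thesis
    proof cases
      case 1
      have "\<bar>a - c\<bar> / max a c \<le> \<bar>b - c\<bar> / max b c"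
        using 1 abc c by (auto simp: max_def divide_simps)
      moreover have "0 \<le> \<bar>a - b\<bar> / max a b" using abc by auto
      ultimately show ?thesis by linarith
    next
      case 2
      have "(b - a) / c \<le> (b - a) / b"
      proof (cases "b = 0")
        case True
        then show ?thesis using 2 abc c by (simp add: divide_simps)
      next
        case False
        then show ?thesis using 2 abc c by (intro divide_left_mono) auto
      qed
      moreover have "(c - a) / c = (b - a) / c + (c - b) / c" by (simp add: diff_divide_distrib)
      ultimately show ?thesis using 2 abc by (simp add: max_def)
    next
      case 3
      have "a / b \<le> a / c" using 3 abc c by (intro divide_left_mono) auto
      then have "\<bar>a - c\<bar> / max a c \<le> \<bar>a - b\<bar> / max a b"
        using 3 abc c by (simp add: max_def diff_divide_distrib)
      moreover have "0 \<le> \<bar>b - c\<bar> / max b c" using abc c by auto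
      ultimately show ?thesis by linarith
    qed
  qed
  show ?thesis
  proof (cases "x \<le> z")
    case True
    then show ?thesis using ordered assms by blast
  next
    case False
    then have "\<bar>z - x\<bar> / max z x \<le> \<bar>z - y\<bar> / max z y + \<bar>y - x\<bar> / max y x"
      using ordered assms by auto
    then show ?thesis by (simp add: abs_minus_commute max.commute add.commute)
  qed
qed

lemma card_le_fat_dim: "fat_shattered \<gamma> F S \<Longrightarrow> enat (card S) \<le> fat_dim \<gamma> F"
  unfolding fat_dim_def by (rule SUP_upper2[of S]) auto

lemma F_W_shatters_powers_of_half:
  assumes "L > 0" "\<gamma> > 0" "\<gamma> \<le> L / 4"
  shows "fat_shattered \<gamma> (F_W L) ((\<lambda>i. (1 / 2) ^ i) ` {..n})"
proof (rule separated_imp_fat_shattered[where d = "\<lambda>x y. L * (\<bar>x - y\<bar> / max x y)"])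
  show "L * (\<bar>x - z\<bar> / max x z) \<le> L * (\<bar>x - y\<bar> / max x y) + L * (\<bar>y - z\<bar> / max y z)"
    if "x \<in> {0..1}" "y \<in> {0..1}" "z \<in> {0..1}" for x y z
    unfolding distrib_left[symmetric]
    using harmonic_triangle[of x y z] that assms by (intro mult_left_mono) auto
  show "f \<in> F_W L" if "f \<in> {0..1} \<rightarrow>\<^sub>E UNIV"
    "\<And>x y. x \<in> {0..1} \<Longrightarrow> y \<in> {0..1} \<Longrightarrow> \<bar>f x - f y\<bar> \<le> L * (\<bar>x - y\<bar> / max x y)" for f
    using harmonic_Lipschitz_in_F_W[OF assms(1) that] by blast
  have less: "1 / 2 \<le> \<bar>(1 / 2) ^ i - (1 / 2) ^ j\<bar> / max ((1 / 2) ^ i) ((1 / 2 :: real) ^ j)"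
    if "i < j" for i j :: nat
  proof -
    have "(1 / 2 :: real) ^ j \<le> (1 / 2) ^ Suc i" using that by (intro power_decreasing) auto
    then have "(1 / 2 :: real) ^ j \<le> (1 / 2) ^ i / 2" by simp
    moreover have "1 / 2 \<le> \<bar>a - b\<bar> / max a b" if "b \<le> a / 2" "0 < a" for a b :: real
      using that by (simp add: max_def field_simps)
    moreover have "(0 :: real) < (1 / 2) ^ i" by simp
    ultimately show ?thesis by blast
  qed
  have far: "1 / 2 \<le> \<bar>s - t\<bar> / max s t"
    if st: "s \<in> (\<lambda>i. (1 / 2) ^ i) ` {..n}" "t \<in> (\<lambda>i. (1 / 2) ^ i) ` {..n}" "s \<noteq> t" for s t :: real
  proof -
    obtain i j where ij: "s = (1 / 2) ^ i" "t = (1 / 2) ^ j" using st by blast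
    with st(3) have "i \<noteq> j" by blast
    then consider "i < j" | "j < i" by linarith
    then show ?thesis
    proof cases
      case 1
      show ?thesis unfolding ij by (rule less[OF 1])
    next
      case 2
      show ?thesis unfolding ij using less[OF 2] by (subst abs_minus_commute, subst max.commute)
    qed
  qed
  show "2 * \<gamma> \<le> L * (\<bar>s - t\<bar> / max s t)"
    if "s \<in> (\<lambda>i. (1 / 2) ^ i) ` {..n}" "t \<in> (\<lambda>i. (1 / 2) ^ i) ` {..n}" "s \<noteq> t" for s t :: real
  proof -
    have "2 * \<gamma> \<le> L * (1 / 2)" using assms by simp
    also have "\<dots> \<le> L * (\<bar>s - t\<bar> / max s t)"
      using far[OF that] assms(1) by (intro mult_left_mono) auto
    finally show ?thesis .
  qed
qed (use assms in \<open>auto simp: abs_minus_commute max.commute power_le_one\<close>)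

lemma fat_dim_F_W:
  assumes "L > 0" "\<gamma> > 0" "\<gamma> \<le> L / 4"
  shows "fat_dim \<gamma> (F_W L) = \<infinity>"
proof -
  have lower: "enat n \<le> fat_dim \<gamma> (F_W L)" for n
  proof -
    have "inj_on (\<lambda>i. (1 / 2 :: real) ^ i) {..n}" by (auto intro!: inj_onI simp: power_one_over)
    then have "card ((\<lambda>i. (1 / 2 :: real) ^ i) ` {..n}) = Suc n" by (simp add: card_image)
    then have "enat (Suc n) \<le> fat_dim \<gamma> (F_W L)"
      using card_le_fat_dim[OF F_W_shatters_powers_of_half[OF assms, of n]] by simp
    then show ?thesis by (rule order_trans[rotated]) simp
  qed
  show ?thesis
  proof (cases "fat_dim \<gamma> (F_W L)")
    case (enat k)
    then show ?thesis using lower[of "Suc k"] by simp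
  qed simp
qed

text \<open>For \<open>n = 0\<close> the grid \<open>real i / real n\<close> degenerates, by division by zero, to the single
  point \<open>0\<close>, which is the intended shattered set in that case.\<close>

lemma F_S_shatters_grid:
  assumes "L > 0" "\<gamma> > 0" "2 * \<gamma> * real n \<le> L"
  shows "fat_shattered \<gamma> (F_S L) ((\<lambda>i. real i / real n) ` {..n})"
proof (rule separated_imp_fat_shattered[where d = "\<lambda>x y. L * \<bar>x - y\<bar>"])
  show "L * \<bar>x - z\<bar> \<le> L * \<bar>x - y\<bar> + L * \<bar>y - z\<bar>" for x y z
    unfolding distrib_left[symmetric] using assms by (intro mult_left_mono) auto
  show "f \<in> F_S L" if "f \<in> {0..1} \<rightarrow>\<^sub>E UNIV"
    "\<And>x y. x \<in> {0..1} \<Longrightarrow> y \<in> {0..1} \<Longrightarrow> \<bar>f x - f y\<bar> \<le> L * \<bar>x - y\<bar>" for f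
    using Lipschitz_in_F_S[OF assms(1) that] by blast
  show "2 * \<gamma> \<le> L * \<bar>s - t\<bar>"
    if st: "s \<in> (\<lambda>i. real i / real n) ` {..n}" "t \<in> (\<lambda>i. real i / real n) ` {..n}" "s \<noteq> t"
    for s t
  proof -
    obtain i j where ij: "s = real i / real n" "t = real j / real n" using st by blast
    with st have n: "n > 0" and "i \<noteq> j" by (auto intro!: Nat.gr0I)
    then have "1 \<le> \<bar>real i - real j\<bar>" by linarith
    then have "2 * \<gamma> * real n \<le> L * \<bar>real i - real j\<bar>"
      using assms mult_left_mono[of 1 "\<bar>real i - real j\<bar>" L] by linarith
    moreover have "\<bar>s - t\<bar> = \<bar>real i - real j\<bar> / real n"
      unfolding ij by (simp flip: diff_divide_distrib)
    ultimately show ?thesis using n by (simp add: pos_le_divide_eq)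
  qed
qed (use assms in \<open>auto simp: abs_minus_commute divide_simps\<close>)

section \<open>Upper bound for the strong class\<close>

text \<open>A point \<open>x\<close> between \<open>a\<close> and \<open>b\<close> sees slope at least the secant slope towards one of the two
  ends, by the triangle inequality for \<open>f a\<close>, \<open>f x\<close>, \<open>f b\<close>.\<close>

lemma secant_le_local_slope:
  assumes "a \<in> {0..1}" "b \<in> {0..1}" "a < x" "x < b"
  shows "ennreal (\<bar>f b - f a\<bar> / (b - a)) \<le> local_slope f x"
proof -
  define q where "q = \<bar>f b - f a\<bar> / (b - a)"
  have upper: "ennreal q \<le> local_slope f x"
    if "c \<in> {0..1} - {x}" "q \<le> \<bar>f x - f c\<bar> / \<bar>x - c\<bar>" for c
    unfolding local_slope_def by (rule SUP_upper2[OF that(1)]) (rule ennreal_leI[OF that(2)])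
  have "q * (x - a) \<le> \<bar>f x - f a\<bar> \<or> q * (b - x) \<le> \<bar>f x - f b\<bar>"
  proof (rule ccontr)
    assume "\<not> ?thesis"
    then have "\<bar>f b - f a\<bar> < q * (x - a) + q * (b - x)" by linarith
    also have "\<dots> = q * (b - a)" by (simp add: algebra_simps)
    also have "\<dots> = \<bar>f b - f a\<bar>" using assms by (simp add: q_def)
    finally show False by simp
  qed
  then show ?thesis
    unfolding q_def[symmetric]
    using upper[of a] upper[of b] assms by (auto simp: le_divide_eq)
qed

text \<open>The local slope is minorised by the step function \<open>\<Sum>i<n. c i * indicator (A i)\<close> of secant
  slopes, whose mean is the variation. Only the step function has to be measurable.\<close>

lemma variation_le_strong_smoothness:
  fixes x :: "nat \<Rightarrow> real"
  assumes mono: "strict_mono_on {..n} x" and x01: "\<And>i. i \<le> n \<Longrightarrow> x i \<in> {0..1}"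
  shows "ennreal (\<Sum>i<n. \<bar>f (x (Suc i)) - f (x i)\<bar>) \<le> strong_smoothness f"
proof -
  define A where "A i = {x i<..<x (Suc i)}" for i
  define c where "c i = ennreal (\<bar>f (x (Suc i)) - f (x i)\<bar> / (x (Suc i) - x i))" for i
  have step: "x i < x (Suc i)" if "i < n" for i
    using that by (intro strict_mono_onD[OF mono]) auto
  have le: "x (Suc i) \<le> x j" if "i < j" "j < n" for i j
    using that by (intro strict_mono_on_leD[OF mono]) auto
  have disj: "disjoint_family_on A {..<n}"
    unfolding disjoint_family_on_def A_def
    by (auto simp: neq_iff dest: le)
  have pointwise: "(\<Sum>i<n. c i * indicator (A i) t) \<le> local_slope f t" for t
  proof (cases "\<exists>i<n. t \<in> A i")
    case True
    then obtain i where i: "i < n" "t \<in> A i" by blast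
    have "(\<Sum>i<n. c i * indicator (A i) t) = (\<Sum>j\<in>{i}. c j * indicator (A j) t)"
      using disj i by (intro sum.mono_neutral_right)
        (auto simp: disjoint_family_on_def split: split_indicator)
    also have "\<dots> = c i" using i by simp
    also have "\<dots> \<le> local_slope f t"
      unfolding c_def using i x01[of i] x01[of "Suc i"]
      by (intro secant_le_local_slope) (auto simp: A_def)
    finally show ?thesis .
  next
    case False
    then show ?thesis by (simp add: sum.neutral)
  qed
  have "ennreal (\<Sum>i<n. \<bar>f (x (Suc i)) - f (x i)\<bar>) = (\<Sum>i<n. c i * emeasure unif01 (A i))"
  proof -
    have "c i * emeasure unif01 (A i) = ennreal \<bar>f (x (Suc i)) - f (x i)\<bar>" if i: "i < n" for i
    proof -
      have "{0..1} \<inter> A i = A i" using x01[of i] x01[of "Suc i"] i by (auto simp: A_def)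
      then have "emeasure unif01 (A i) = ennreal (x (Suc i) - x i)"
        using step[OF i] by (subst emeasure_unif01) (auto simp: A_def)
      then show ?thesis using step[OF i] by (simp add: c_def flip: ennreal_mult)
    qed
    then show ?thesis by simp
  qed
  also have "\<dots> = (\<integral>\<^sup>+ t. (\<Sum>i<n. c i * indicator (A i) t) \<partial>unif01)"
    by (subst nn_integral_sum) (auto simp: A_def unif01_def nn_integral_cmult_indicator)
  also have "\<dots> \<le> strong_smoothness f"
    unfolding strong_smoothness_def by (rule nn_integral_mono) (rule pointwise)
  finally show ?thesis .
qed

text \<open>Since the outer supremum over offsets need not be attained, a shattered set yields offsets
  only for every smaller margin.\<close>

lemma fat_shattered_offsets:
  assumes "fat_shattered \<gamma> F S" "\<delta> < \<gamma>"
  obtains r where "\<And>y. y \<in> S \<rightarrow>\<^sub>E {-1, 1} \<Longrightarrow> \<exists>f\<in>F. \<forall>s\<in>S. \<delta> \<le> y s * (f s - r s)"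
proof -
  have "ereal \<delta> < (SUP r \<in> S \<rightarrow>\<^sub>E (UNIV :: real set). INF y \<in> S \<rightarrow>\<^sub>E {-1, 1 :: real}.
        SUP f \<in> F. INF x \<in> S. ereal (y x * (f x - r x)))"
    using assms less_le_trans[of "ereal \<delta>" "ereal \<gamma>"] unfolding fat_shattered_def by auto
  then obtain r where r: "ereal \<delta> < (INF y \<in> S \<rightarrow>\<^sub>E {-1, 1 :: real}.
        SUP f \<in> F. INF x \<in> S. ereal (y x * (f x - r x)))"
    unfolding less_SUP_iff by blast
  show thesis
  proof (rule that)
    fix y :: "real \<Rightarrow> real" assume "y \<in> S \<rightarrow>\<^sub>E {-1, 1}"
    then have "ereal \<delta> < (SUP f \<in> F. INF x \<in> S. ereal (y x * (f x - r x)))"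
      using less_INF_D[OF r] by blast
    then obtain f where f: "f \<in> F" "ereal \<delta> < (INF x \<in> S. ereal (y x * (f x - r x)))"
      unfolding less_SUP_iff by blast
    then show "\<exists>f\<in>F. \<forall>s\<in>S. \<delta> \<le> y s * (f s - r s)"
      using less_INF_D[OF f(2)] by (intro bexI[OF _ f(1)]) (auto intro: less_imp_le)
  qed
qed

text \<open>The functions \<open>f\<close> and \<open>g\<close> realise opposite alternating sign patterns. On a gap, one of
  them alone may have no increment at all, when \<open>r\<close> jumps against its signs; adding the increments of
  both eliminates \<open>r\<close>.\<close>

lemma F_S_shattered_margin:
  assumes "L > 0" "fat_shattered \<gamma> (F_S L) S" "card S = Suc n" "\<delta> < \<gamma>"
  shows "2 * \<delta> * real n \<le> L"
proof -
  have S: "finite S" "S \<subseteq> {0..1}" using assms by (auto simp: fat_shattered_def)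
  define x where "x i = sorted_list_of_set S ! i" for i
  have len: "length (sorted_list_of_set S) = Suc n" using assms by simp
  have mono: "strict_mono_on {..n} x"
    unfolding x_def using strict_sorted_list_of_set[of S] len
    by (intro strict_mono_onI) (auto simp: sorted_wrt_iff_nth_less)
  have inS: "x i \<in> S" if "i \<le> n" for i
    using nth_mem[of i "sorted_list_of_set S"] that len S by (simp add: x_def)
  obtain r where r: "\<And>y. y \<in> S \<rightarrow>\<^sub>E {-1, 1} \<Longrightarrow> \<exists>f\<in>F_S L. \<forall>s\<in>S. \<delta> \<le> y s * (f s - r s)"
    using fat_shattered_offsets[OF assms(2,4)] by blast
  define y where "y s = (- 1 :: real) ^ inv_into {..n} x s" for s
  have y_x: "y (x i) = (- 1) ^ i" if "i \<le> n" for i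
    unfolding y_def using that inv_into_f_f[OF strict_mono_on_imp_inj_on[OF mono], of i] by simp
  have y1: "y s = 1 \<or> y s = - 1" for s
    unfolding y_def by (cases "even (inv_into {..n} x s)") auto
  obtain f where f: "f \<in> F_S L" "\<forall>s\<in>S. \<delta> \<le> y s * (f s - r s)"
    using r[of "restrict y S"] y1 by auto
  obtain g where g: "g \<in> F_S L" "\<forall>s\<in>S. \<delta> \<le> - y s * (g s - r s)"
    using r[of "restrict (\<lambda>s. - y s) S"] y1 by fastforce
  define V where "V h = (\<Sum>i<n. \<bar>h (x (Suc i)) - h (x i)\<bar>)" for h :: "real \<Rightarrow> real"
  have V_le: "V h \<le> L" if "h \<in> F_S L" for h
  proof -
    have "ennreal (V h) \<le> strong_smoothness h"
      unfolding V_def using inS S by (intro variation_le_strong_smoothness[OF mono]) blast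
    also have "\<dots> \<le> ennreal L" using that by (simp add: F_S_def)
    finally show ?thesis using assms(1) by (simp add: ennreal_le_iff)
  qed
  have gap: "4 * \<delta> \<le> \<bar>f (x (Suc i)) - f (x i)\<bar> + \<bar>g (x (Suc i)) - g (x i)\<bar>" if "i < n" for i
  proof -
    have flip: "y (x (Suc i)) = - y (x i)" using that by (simp add: y_x)
    have at_i: "\<delta> \<le> y (x i) * (f (x i) - r (x i))" "\<delta> \<le> - y (x i) * (g (x i) - r (x i))"
      using f g inS[of i] that by auto
    have at_Suc: "\<delta> \<le> - y (x i) * (f (x (Suc i)) - r (x (Suc i)))"
      "\<delta> \<le> y (x i) * (g (x (Suc i)) - r (x (Suc i)))"
      using f(2) g(2) inS[of "Suc i"] that flip by fastforce+
    show ?thesis using y1[of "x i"] at_i at_Suc by auto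
  qed
  have "real n * (4 * \<delta>) \<le> V f + V g"
    unfolding V_def sum.distrib[symmetric]
    using sum_bounded_below[of "{..<n}" "4 * \<delta>"] gap by auto
  then show ?thesis using V_le[OF f(1)] V_le[OF g(1)] by (simp add: algebra_simps)
qed

lemma fat_dim_F_S:
  assumes "L > 0" "\<gamma> > 0"
  shows "fat_dim \<gamma> (F_S L) = enat (1 + nat \<lfloor>L / (2 * \<gamma>)\<rfloor>)"
proof (rule antisym)
  define n where "n = nat \<lfloor>L / (2 * \<gamma>)\<rfloor>"
  have "real n \<le> L / (2 * \<gamma>)" using assms by (simp add: n_def)
  then have "2 * \<gamma> * real n \<le> L" using assms by (simp add: field_simps)
  from F_S_shatters_grid[OF assms this]
  have "enat (card ((\<lambda>i. real i / real n) ` {..n})) \<le> fat_dim \<gamma> (F_S L)"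
    by (rule card_le_fat_dim)
  moreover have "inj_on (\<lambda>i. real i / real n) {..n}" by (rule inj_onI) (cases "n = 0"; simp)
  ultimately show "enat (1 + nat \<lfloor>L / (2 * \<gamma>)\<rfloor>) \<le> fat_dim \<gamma> (F_S L)"
    by (simp add: card_image n_def)
  show "fat_dim \<gamma> (F_S L) \<le> enat (1 + nat \<lfloor>L / (2 * \<gamma>)\<rfloor>)"
    unfolding fat_dim_def
  proof (rule SUP_least, clarify)
    fix S assume sh: "fat_shattered \<gamma> (F_S L) S"
    show "enat (card S) \<le> enat (1 + nat \<lfloor>L / (2 * \<gamma>)\<rfloor>)"
    proof (cases "card S")
      case (Suc m)
      have "m \<le> nat \<lfloor>L / (2 * \<gamma>)\<rfloor>"
      proof (cases "m = 0")
        case False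
        have "\<gamma> \<le> L / (2 * real m)"
        proof (rule dense_le)
          fix \<delta> assume "\<delta> < \<gamma>"
          then show "\<delta> \<le> L / (2 * real m)"
            using F_S_shattered_margin[OF assms(1) sh Suc] False by (simp add: field_simps)
        qed
        then have "real m \<le> L / (2 * \<gamma>)" using False assms by (simp add: field_simps)
        then show ?thesis by (simp add: le_nat_floor)
      qed simp
      then show ?thesis using Suc by simp
    qed simp
  qed
qed

theorem theorem1p3:
  fixes L :: real
  assumes "L > 0"
  shows "(\<forall>\<gamma>::real. \<gamma> > 0 \<and> \<gamma> \<le> L / 6 \<longrightarrow> fat_dim \<gamma> (F_W L) = \<infinity>) \<and>
         (\<forall>\<gamma>::real. \<gamma> > 0 \<longrightarrow> fat_dim \<gamma> (F_S L) = enat (1 + nat \<lfloor>L / (2 * \<gamma>)\<rfloor>))"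
  using assms fat_dim_F_W[of L] fat_dim_F_S[of L] by simp

end
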